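(* Let $M,N,K$ be positive integers, let $\mathbf A\in\mathbb R^{M\times N}$, and define on $\mathbb R^{M\times K}\times\mathbb R^{K\times N}$ the functions $$g(\mathbf U,\mathbf Z)=\tfrac12\|\mathbf A-\mathbf U\mathbf Z\|_F^2,\quad h_1(\mathbf U,\mathbf Z)=\Big(\tfrac{\|\mathbf U\|_F^2+\|\mathbf Z\|_F^2}{2}\Big)^2,\quad h_2(\mathbf U,\mathbf Z)=\tfrac{\|\mathbf U\|_F^2+\|\mathbf Z\|_F^2}{2}.$$ Then, for every $L\ge 1$, the function $g$ satisfies the $L$-smad property on $\mathbb R^{M\times K}\times\mathbb R^{K\times N}$ with respect to $$h_a(\mathbf U,\mathbf Z)=3h_1(\mathbf U,\mathbf Z)+\|\mathbf A\|_F\,h_2(\mathbf U,\mathbf Z).$$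
   Context: $\|\cdot\|_F$ is the Frobenius norm. A function $g$ is called $L$-smooth adaptable ($L$-smad) on a nonempty open convex set $C$ with respect to a convex function $h$ (that is $C^1$ on $C$) if and only if both $Lh-g$ and $Lh+g$ are convex on $C$. *)

theory Defs
  imports "HOL-Analysis.Analysis"
begin

definition frobenius_norm :: "real ^ 'n ^ 'm \<Rightarrow> real" where
  "frobenius_norm A = sqrt (\<Sum>i\<in>UNIV. \<Sum>j\<in>UNIV. (A $ i $ j)\<^sup>2)"

definition continuously_differentiable_on ::
  "('a::real_normed_vector \<Rightarrow> real) \<Rightarrow> 'a set \<Rightarrow> bool" where
  "continuously_differentiable_on h C \<longleftrightarrow>
     (\<exists>h' :: 'a \<Rightarrow> 'a \<Rightarrow>\<^sub>L real.
        (\<forall>x\<in>C. (h has_derivative blinfun_apply (h' x)) (at x)) \<and> continuous_on C h')"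

(* The standing assumptions on C and h are conjuncts of the property, so asserting
   smad L C h g also asserts that they hold. *)
definition smad ::
  "real \<Rightarrow> ('a::real_normed_vector) set \<Rightarrow> ('a \<Rightarrow> real) \<Rightarrow> ('a \<Rightarrow> real) \<Rightarrow> bool" where
  "smad L C h g \<longleftrightarrow>
     C \<noteq> {} \<and> open C \<and> convex C \<and>
     convex_on C h \<and> continuously_differentiable_on h C \<and>
     convex_on C (\<lambda>x. L * h x - g x) \<and> convex_on C (\<lambda>x. L * h x + g x)"

definition g_fun ::
  "real ^ 'n ^ 'm \<Rightarrow> (real ^ 'k ^ 'm) \<times> (real ^ 'n ^ 'k) \<Rightarrow> real" where
  "g_fun A = (\<lambda>(U, Z). (1 / 2) * (frobenius_norm (A - U ** Z))\<^sup>2)"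

definition h1_fun :: "(real ^ 'k ^ 'm) \<times> (real ^ 'n ^ 'k) \<Rightarrow> real" where
  "h1_fun = (\<lambda>(U, Z). (((frobenius_norm U)\<^sup>2 + (frobenius_norm Z)\<^sup>2) / 2)\<^sup>2)"

definition h2_fun :: "(real ^ 'k ^ 'm) \<times> (real ^ 'n ^ 'k) \<Rightarrow> real" where
  "h2_fun = (\<lambda>(U, Z). ((frobenius_norm U)\<^sup>2 + (frobenius_norm Z)\<^sup>2) / 2)"

definition ha_fun ::
  "real ^ 'n ^ 'm \<Rightarrow> (real ^ 'k ^ 'm) \<times> (real ^ 'n ^ 'k) \<Rightarrow> real" where
  "ha_fun A = (\<lambda>x. 3 * h1_fun x + frobenius_norm A * h2_fun x)"

end

theory Submission
  imports Defs
begin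

text \<open>
  Two features of the problem matter: the Frobenius norm is the Euclidean norm of a matrix, and the
  matrix product is bilinear and contractive, \<open>\<parallel>U Z\<parallel> \<le> \<parallel>U\<parallel> \<parallel>Z\<parallel>\<close>. So let \<open>p\<close> be any contractive
  bilinear map, \<open>G (u, v) = \<parallel>a - p u v\<parallel>\<^sup>2 / 2\<close>, and \<open>H x = 3/4 \<parallel>x\<parallel>\<^sup>4 + \<parallel>a\<parallel>/2 \<parallel>x\<parallel>\<^sup>2\<close>, which is what
  \<open>3 h\<^sub>1 + \<parallel>a\<parallel> h\<^sub>2\<close> becomes in the product norm.

  Convexity is tested by second derivatives along lines. At a point \<open>x = (u, v)\<close> in the direction
  \<open>e = (d, q)\<close>, the second derivative of \<open>G\<close> is
  \<open>\<parallel>p d v + p u q\<parallel>\<^sup>2 - 2 \<langle>a - p u v, p d q\<rangle>\<close>. Contractivity and Cauchy-Schwarz bound the first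
  term by \<open>\<parallel>x\<parallel>\<^sup>2 \<parallel>e\<parallel>\<^sup>2\<close>, and with \<open>2 \<parallel>u\<parallel> \<parallel>v\<parallel> \<le> \<parallel>x\<parallel>\<^sup>2\<close> and \<open>2 \<parallel>d\<parallel> \<parallel>q\<parallel> \<le> \<parallel>e\<parallel>\<^sup>2\<close> the second by
  \<open>(\<parallel>a\<parallel> + \<parallel>x\<parallel>\<^sup>2 / 2) \<parallel>e\<parallel>\<^sup>2\<close>. The second derivative of \<open>H\<close> is
  \<open>6 \<langle>x, e\<rangle>\<^sup>2 + (3 \<parallel>x\<parallel>\<^sup>2 + \<parallel>a\<parallel>) \<parallel>e\<parallel>\<^sup>2\<close>, which is at least the sum of these bounds. Hence
  \<open>L H + s G\<close> is convex whenever \<open>\<bar>s\<bar> \<le> L\<close>: for \<open>L \<ge> 1\<close> the choices \<open>s = -1\<close> and \<open>s = 1\<close> give the two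
  convexity claims about \<open>G\<close>, and \<open>s = 0\<close> with the factor \<open>1\<close> gives the convexity of \<open>H\<close>.
\<close>

section \<open>Convexity along lines\<close>

lemma convex_on_UNIV_if_convex_on_lines:
  fixes f :: "'a::real_vector \<Rightarrow> real"
  assumes "\<And>x e. convex_on UNIV (\<lambda>t::real. f (x + t *\<^sub>R e))"
  shows "convex_on UNIV f"
proof (rule convex_onI)
  fix t :: real and x y :: 'a
  assume "0 < t" "t < 1"
  then show "f ((1 - t) *\<^sub>R x + t *\<^sub>R y) \<le> (1 - t) * f x + t * f y"
    using convex_onD[OF assms[of x "y - x"], of t 0 1] by (simp add: algebra_simps)
qed simp

lemma first_derivative_quartic_on_line:
  fixes x e :: "'a::real_inner"
  shows "((\<lambda>t. 3/4 * (norm (x + t *\<^sub>R e))^4 + c/2 * (norm (x + t *\<^sub>R e))\<^sup>2) has_real_derivative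
           (3 * (norm (x + t *\<^sub>R e))\<^sup>2 + c) * ((x + t *\<^sub>R e) \<bullet> e)) (at t)"
proof -
  have "norm y ^ 4 = (y \<bullet> y)\<^sup>2" for y :: 'a
    by (simp flip: power2_norm_eq_inner)
  then show ?thesis
    unfolding power2_norm_eq_inner has_field_derivative_def
    by (auto intro!: derivative_eq_intros simp: algebra_simps inner_commute power2_eq_square)
qed

lemma second_derivative_quartic_on_line:
  fixes x e :: "'a::real_inner"
  shows "((\<lambda>t. (3 * (norm (x + t *\<^sub>R e))\<^sup>2 + c) * ((x + t *\<^sub>R e) \<bullet> e)) has_real_derivative
           6 * ((x + t *\<^sub>R e) \<bullet> e)\<^sup>2 + (3 * (norm (x + t *\<^sub>R e))\<^sup>2 + c) * (norm e)\<^sup>2) (at t)"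
  unfolding power2_norm_eq_inner has_field_derivative_def
  by (auto intro!: derivative_eq_intros ext
      simp: inner_add_left inner_add_right inner_commute power2_eq_square algebra_simps)

lemma first_derivative_half_norm_square_on_parabola:
  fixes r w c :: "'a::real_inner"
  shows "((\<lambda>t. 1/2 * (norm (r - t *\<^sub>R w - t\<^sup>2 *\<^sub>R c))\<^sup>2) has_real_derivative
           - ((r - t *\<^sub>R w - t\<^sup>2 *\<^sub>R c) \<bullet> (w + (2 * t) *\<^sub>R c))) (at t)"
  unfolding power2_norm_eq_inner has_field_derivative_def
  by (auto intro!: derivative_eq_intros ext
      simp: inner_add_left inner_add_right inner_diff_left inner_diff_right inner_commute
        power2_eq_square algebra_simps)

lemma second_derivative_half_norm_square_on_parabola:
  fixes r w c :: "'a::real_inner"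
  shows "((\<lambda>t. - ((r - t *\<^sub>R w - t\<^sup>2 *\<^sub>R c) \<bullet> (w + (2 * t) *\<^sub>R c))) has_real_derivative
           (norm (w + (2 * t) *\<^sub>R c))\<^sup>2 - 2 * ((r - t *\<^sub>R w - t\<^sup>2 *\<^sub>R c) \<bullet> c)) (at t)"
  unfolding power2_norm_eq_inner has_field_derivative_def
  by (auto intro!: derivative_eq_intros ext
      simp: inner_add_left inner_add_right inner_diff_left inner_diff_right inner_commute
        power2_eq_square algebra_simps)

section \<open>Residuals of contractive bilinear maps\<close>

text \<open>
  For a bilinear \<open>p\<close>, the quantity inside the absolute value is the second derivative at \<open>(u, v)\<close>, in
  the direction \<open>(d, q)\<close>, of half the squared norm of the residual \<open>a - p u v\<close>.
\<close>

lemma residual_second_derivative_bound: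
  fixes p :: "'a::real_inner \<Rightarrow> 'b::real_inner \<Rightarrow> 'c::real_inner"
  assumes contractive: "\<And>u v. norm (p u v) \<le> norm u * norm v"
  shows "\<bar>(norm (p d v + p u q))\<^sup>2 - 2 * ((a - p u v) \<bullet> p d q)\<bar>
           \<le> (3/2 * (norm (u, v))\<^sup>2 + norm a) * (norm (d, q))\<^sup>2"
proof -
  define X E where "X = (norm (u, v))\<^sup>2" and "E = (norm (d, q))\<^sup>2"
  have X: "X = (norm u)\<^sup>2 + (norm v)\<^sup>2" and E: "E = (norm d)\<^sup>2 + (norm q)\<^sup>2"
    by (simp_all add: X_def E_def norm_Pair)
  have "norm (p d v + p u q) \<le> norm d * norm v + norm u * norm q"
    using norm_triangle_ineq[of "p d v" "p u q"] contractive[of d v] contractive[of u q] by linarith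
  then have "(norm (p d v + p u q))\<^sup>2 \<le> (norm d * norm v + norm u * norm q)\<^sup>2"
    by (simp add: power_mono)
  also have "\<dots> \<le> X * E"
    \<comment> \<open>Cauchy-Schwarz in the plane: the difference of the two sides is a square.\<close>
    using zero_le_power2[of "norm d * norm u - norm q * norm v"]
    by (simp add: X E power2_eq_square algebra_simps)
  finally have 1: "(norm (p d v + p u q))\<^sup>2 \<le> X * E" .
  have "norm (p u v) \<le> X / 2" "norm (p d q) \<le> E / 2"
    using contractive[of u v] contractive[of d q]
      sum_squares_bound[of "norm u" "norm v"] sum_squares_bound[of "norm d" "norm q"]
    by (simp_all add: X E)
  moreover from this have "norm (a - p u v) \<le> norm a + X / 2"
    using norm_triangle_ineq4[of a "p u v"] by linarith
  ultimately have "norm (a - p u v) * norm (p d q) \<le> (norm a + X / 2) * (E / 2)"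
    by (intro mult_mono) (auto simp: X)
  then have 2: "\<bar>2 * ((a - p u v) \<bullet> p d q)\<bar> \<le> (norm a + X / 2) * E"
    using Cauchy_Schwarz_ineq2[of "a - p u v" "p d q"] by (simp add: abs_mult)
  have "\<bar>(norm (p d v + p u q))\<^sup>2 - 2 * ((a - p u v) \<bullet> p d q)\<bar>
      \<le> X * E + (norm a + X / 2) * E"
    using 1 2 zero_le_power2[of "norm (p d v + p u q)"] by linarith
  then show ?thesis
    unfolding X_def[symmetric] E_def[symmetric] by (simp add: algebra_simps)
qed

text \<open>
  On the line through \<open>(u, v)\<close> in the direction \<open>(d, q)\<close> the residual is a parabola
  \<open>r - t w - t\<^sup>2 c\<close>. Up to sign, its velocity at time \<open>t\<close> is \<open>p d v' + p u' q\<close>, where \<open>(u', v')\<close> is the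
  point reached at that time, so the bound on the second derivative at a single point, used at
  \<open>(u', v')\<close>, serves for every \<open>t\<close>.
\<close>

lemma convex_on_quartic_plus_residual:
  fixes p :: "'a::real_inner \<Rightarrow> 'b::real_inner \<Rightarrow> 'c::real_inner"
  assumes "bounded_bilinear p"
    and contractive: "\<And>u v. norm (p u v) \<le> norm u * norm v"
    and s: "\<bar>s\<bar> \<le> L"
  shows "convex_on UNIV
    (\<lambda>x. L * (3/4 * norm x ^ 4 + norm a / 2 * (norm x)\<^sup>2)
       + s * (1/2 * (norm (a - p (fst x) (snd x)))\<^sup>2))"
proof (rule convex_on_UNIV_if_convex_on_lines)
  interpret bounded_bilinear p by fact
  fix x e :: "'a \<times> 'b"
  obtain u v where x: "x = (u, v)" by (cases x)
  obtain d q where e: "e = (d, q)" by (cases e)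
  define r w c where "r = a - p u v" and "w = p d v + p u q" and "c = p d q"
  have residual: "a - p (u + t *\<^sub>R d) (v + t *\<^sub>R q) = r - t *\<^sub>R w - t\<^sup>2 *\<^sub>R c" for t
    by (simp add: r_def w_def c_def add_left add_right scaleR_left scaleR_right algebra_simps
        power2_eq_square)
  have velocity: "p d (v + t *\<^sub>R q) + p (u + t *\<^sub>R d) q = w + (2 * t) *\<^sub>R c" for t
    by (simp add: w_def c_def add_left add_right scaleR_left scaleR_right algebra_simps
        flip: scaleR_2)
  let ?G'' = "\<lambda>t. (norm (w + (2 * t) *\<^sub>R c))\<^sup>2 - 2 * ((r - t *\<^sub>R w - t\<^sup>2 *\<^sub>R c) \<bullet> c)"
  let ?H'' = "\<lambda>t. 6 * ((x + t *\<^sub>R e) \<bullet> e)\<^sup>2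
                 + (3 * (norm (x + t *\<^sub>R e))\<^sup>2 + norm a) * (norm e)\<^sup>2"
  have nonneg: "0 \<le> L * ?H'' t + s * ?G'' t" for t
  proof -
    let ?N = "(norm (x + t *\<^sub>R e))\<^sup>2"
    have "\<bar>?G'' t\<bar> \<le> (3/2 * ?N + norm a) * (norm e)\<^sup>2"
      using residual_second_derivative_bound
        [where p = p and d = d and q = q and u = "u + t *\<^sub>R d" and v = "v + t *\<^sub>R q" and a = a,
         OF contractive]
      unfolding residual velocity by (simp add: x e c_def)
    also have "\<dots> \<le> (3 * ?N + norm a) * (norm e)\<^sup>2"
      by (intro mult_right_mono) auto
    also have "\<dots> \<le> ?H'' t" by simp
    finally have "\<bar>s\<bar> * \<bar>?G'' t\<bar> \<le> L * ?H'' t"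
      using s by (intro mult_mono) auto
    then show ?thesis
      unfolding abs_mult[symmetric] by linarith
  qed
  let ?\<phi> = "\<lambda>t. L * (3/4 * norm (x + t *\<^sub>R e) ^ 4 + norm a / 2 * (norm (x + t *\<^sub>R e))\<^sup>2)
      + s * (1/2 * (norm (r - t *\<^sub>R w - t\<^sup>2 *\<^sub>R c))\<^sup>2)"
  let ?\<phi>' = "\<lambda>t. L * ((3 * (norm (x + t *\<^sub>R e))\<^sup>2 + norm a) * ((x + t *\<^sub>R e) \<bullet> e))
      + s * (- ((r - t *\<^sub>R w - t\<^sup>2 *\<^sub>R c) \<bullet> (w + (2 * t) *\<^sub>R c)))"
  have "(?\<phi> has_real_derivative ?\<phi>' t) (at t)" for t
    by (intro DERIV_add DERIV_cmult first_derivative_quartic_on_line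
        first_derivative_half_norm_square_on_parabola)
  moreover have "(?\<phi>' has_real_derivative L * ?H'' t + s * ?G'' t) (at t)" for t
    by (intro DERIV_add DERIV_cmult second_derivative_quartic_on_line
        second_derivative_half_norm_square_on_parabola)
  ultimately have "convex_on UNIV ?\<phi>"
    using nonneg by (rule f''_ge0_imp_convex[OF convex_UNIV])
  then show "convex_on UNIV (\<lambda>t.
      L * (3/4 * norm (x + t *\<^sub>R e) ^ 4 + norm a / 2 * (norm (x + t *\<^sub>R e))\<^sup>2)
      + s * (1/2 * (norm (a - p (fst (x + t *\<^sub>R e)) (snd (x + t *\<^sub>R e))))\<^sup>2))"
    by (simp add: x e residual)
qed

lemma continuously_differentiable_on_quartic:
  fixes C :: "'a::real_inner set"
  shows "continuously_differentiable_on (\<lambda>x. 3/4 * norm x ^ 4 + c/2 * (norm x)\<^sup>2) C"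
proof -
  let ?h' = "\<lambda>x::'a. (3 * (norm x)\<^sup>2 + c) *\<^sub>R blinfun_inner_left x"
  have norm4: "norm y ^ 4 = (y \<bullet> y)\<^sup>2" for y :: 'a
    by (simp flip: power2_norm_eq_inner)
  have "((\<lambda>x. 3/4 * norm x ^ 4 + c/2 * (norm x)\<^sup>2) has_derivative blinfun_apply (?h' x)) (at x)"
    for x :: 'a
    unfolding norm4 power2_norm_eq_inner
    by (auto intro!: derivative_eq_intros ext
        simp: blinfun.scaleR_left blinfun.add_left inner_commute power2_eq_square algebra_simps)
  moreover have "continuous_on C ?h'"
    by (intro continuous_intros bounded_linear.continuous_on[OF bounded_linear_blinfun_inner_left])
  ultimately show ?thesis
    unfolding continuously_differentiable_on_def by (intro exI[of _ ?h']) simp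
qed

section \<open>Matrices with the Frobenius norm\<close>

lemma frobenius_norm_eq_norm: "frobenius_norm A = norm A"
  by (simp add: frobenius_norm_def norm_vec_def L2_set_def sum_nonneg)

text \<open>
  Each entry of \<open>U Z\<close> is the inner product of a row of \<open>U\<close> and a column of \<open>Z\<close>. Cauchy-Schwarz for
  the entries and summation over all rows and columns give the product of the two norms.
\<close>

lemma norm_matrix_matrix_mult_le:
  fixes U :: "real ^ 'k ^ 'm" and Z :: "real ^ 'n ^ 'k"
  shows "norm (U ** Z) \<le> norm U * norm Z"
proof (rule power2_le_imp_le)
  have norm_square: "(norm B)\<^sup>2 = (\<Sum>i\<in>UNIV. \<Sum>j\<in>UNIV. (B $ i $ j)\<^sup>2)"
    for B :: "real ^ 'x ^ 'y"
    by (simp add: norm_vec_def L2_set_def sum_nonneg)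
  have "(norm (U ** Z))\<^sup>2 = (\<Sum>i\<in>UNIV. \<Sum>j\<in>UNIV. (\<Sum>l\<in>UNIV. U $ i $ l * Z $ l $ j)\<^sup>2)"
    by (simp add: norm_square matrix_matrix_mult_def)
  also have "\<dots> \<le> (\<Sum>i\<in>UNIV. \<Sum>j\<in>UNIV. (\<Sum>l\<in>UNIV. (U $ i $ l)\<^sup>2) * (\<Sum>l\<in>UNIV. (Z $ l $ j)\<^sup>2))"
    by (intro sum_mono Cauchy_Schwarz_ineq_sum)
  also have "\<dots> = (norm U)\<^sup>2 * (\<Sum>j\<in>UNIV. \<Sum>l\<in>UNIV. (Z $ l $ j)\<^sup>2)"
    by (simp add: norm_square sum_product)
  also have "(\<Sum>j\<in>UNIV. \<Sum>l\<in>UNIV. (Z $ l $ j)\<^sup>2) = (norm Z)\<^sup>2"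
    unfolding norm_square by (rule sum.swap)
  finally show "(norm (U ** Z))\<^sup>2 \<le> (norm U * norm Z)\<^sup>2"
    by (simp add: power_mult_distrib)
qed simp

lemma bounded_bilinear_matrix_matrix_mult:
  "bounded_bilinear ((**) :: real ^ 'k ^ 'm \<Rightarrow> real ^ 'n ^ 'k \<Rightarrow> real ^ 'n ^ 'm)"
proof
  show "\<exists>K. \<forall>(U :: real ^ 'k ^ 'm) (Z :: real ^ 'n ^ 'k). norm (U ** Z) \<le> norm U * norm Z * K"
    by (rule exI[of _ 1]) (simp add: norm_matrix_matrix_mult_le)
qed (simp_all add: vec_eq_iff matrix_matrix_mult_def distrib_left distrib_right sum.distrib
      sum_distrib_left mult_ac)

lemma g_fun_eq: "g_fun A = (\<lambda>x. 1/2 * (norm (A - fst x ** snd x))\<^sup>2)"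
  by (simp add: g_fun_def frobenius_norm_eq_norm case_prod_unfold)

lemma ha_fun_eq:
  fixes A :: "real ^ 'n ^ 'm"
  shows "ha_fun A = (\<lambda>x :: (real ^ 'k ^ 'm) \<times> (real ^ 'n ^ 'k).
    3/4 * norm x ^ 4 + norm A / 2 * (norm x)\<^sup>2)"
proof
  fix x :: "(real ^ 'k ^ 'm) \<times> (real ^ 'n ^ 'k)"
  have "norm x ^ 4 = ((norm x)\<^sup>2)\<^sup>2" by simp
  moreover have "(norm x)\<^sup>2 = (norm (fst x))\<^sup>2 + (norm (snd x))\<^sup>2"
    by (simp add: norm_prod_def)
  ultimately show "ha_fun A x = 3/4 * norm x ^ 4 + norm A / 2 * (norm x)\<^sup>2"
    by (simp add: ha_fun_def h1_fun_def h2_fun_def frobenius_norm_eq_norm case_prod_beta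
        power_divide)
qed

theorem proposition2p1:
  fixes A :: "real ^ 'n ^ 'm" and L :: real
  assumes "L \<ge> 1"
  shows "smad L (UNIV :: ((real ^ 'k ^ 'm) \<times> (real ^ 'n ^ 'k)) set) (ha_fun A) (g_fun A)"
proof -
  let ?C = "UNIV :: ((real ^ 'k ^ 'm) \<times> (real ^ 'n ^ 'k)) set"
  have convex: "convex_on ?C (\<lambda>x. M * ha_fun A x + s * g_fun A x)" if "\<bar>s\<bar> \<le> M" for M s
    unfolding ha_fun_eq g_fun_eq
    using bounded_bilinear_matrix_matrix_mult norm_matrix_matrix_mult_le that
    by (rule convex_on_quartic_plus_residual)
  have "convex_on ?C (ha_fun A)"
    using convex[of 0 1] by simp
  moreover have "convex_on ?C (\<lambda>x. L * ha_fun A x - g_fun A x)"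
    using convex[of "-1" L] assms by simp
  moreover have "convex_on ?C (\<lambda>x. L * ha_fun A x + g_fun A x)"
    using convex[of 1 L] assms by simp
  moreover have "continuously_differentiable_on (ha_fun A) ?C"
    unfolding ha_fun_eq by (rule continuously_differentiable_on_quartic)
  ultimately show ?thesis
    by (simp add: smad_def)
qed

end
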